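(* Let $[X,R]\in\mathbf{R}(n)$ and let $P$ be its associated Dyck path. Then $[X,R]$ is a lattice if and only if $P$ starts and ends with a peak and does not contain the pattern $DDUU$.
   Context: For a finite set $X$, let $\mathcal{D}=\{(x,x)\mid x\in X\}$; for a binary relation $\theta$ on $X$ let $\overline{\theta}=\theta\cup\theta^{-1}$; for binary relations $A,B$ on $X$, $A\circ B=\{(x,z)\mid \exists y\in X:\ xAy \text{ and } yBz\}$. Let $\mathcal{O}(X)$ be the set of strict order relations on $X$ (irreflexive and transitive binary relations). A Catalan pair on $X$ is an ordered pair $(S,R)$ of binary relations on $X$ such that: (ord S) $S\in\mathcal{O}(X)$; (ord R) $R\in\mathcal{O}(X)$; (tot) $\overline{R}\cup\overline{S}=X^2\setminus\mathcal{D}$; (inters) $\overline{R}\cap\overline{S}=\emptyset$; (comp) $S\circ R\subseteq R$. Its size is $|X|$. Two Catalan pairs are isomorphic when there is a bijection between their underlying sets that preserves and reflects both the first and the second components. $[X,R]$ denotes the poset on $X$ with strict order $R$. $\mathbf{R}(n)$ is the set of posets $[X,R]$ with $|X|=n$ for which there exists $S$ such that $(S,R)$ is a Catalan pair on $X$. A Dyck path of semilength $n$ is a word with $n$ letters $U$ (up steps) and $n$ letters $D$ (down steps) in which every prefix has at least as many $U$'s as $D$'s. Its tunnels are the $n$ pairs consisting of an up step and its matching down step (as in matching parentheses). On the set of tunnels of $P$ define: $x\,S_P\,y$ when $x$ lies above $y$ (i.e. the up and down steps of $x$ both lie strictly between the up and down steps of $y$), and $x\,R_P\,y$ when $x$ is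 completely on the left of $y$ (i.e. the down step of $x$ comes before the up step of $y$). Then $(S_P,R_P)$ is a Catalan pair and $P\mapsto (S_P,R_P)$ gives a bijection from Dyck paths of semilength $n$ to isomorphism classes of Catalan pairs of size $n$. Since the second component determines a Catalan pair up to isomorphism, for $[X,R]\in\mathbf{R}(n)$ there is a unique Dyck path $P$ of semilength $n$ with $[X,R]$ isomorphic to the poset of tunnels of $P$ ordered by $R_P$; this is the Dyck path associated with $[X,R]$. "Starts (ends) with a peak" means that the first (last) two letters of $P$ are $UD$; "contains the pattern $DDUU$" means that $DDUU$ occurs as a factor of consecutive letters of $P$. *)

theory Defs
  imports "HOL-Algebra.Lattice" "HOL-Library.Sublist"
begin

section \<open>Catalan pairs\<close>

definition strict_orders :: "'a set \<Rightarrow> 'a rel set"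
  where "strict_orders X = {r. r \<subseteq> X \<times> X \<and> irrefl r \<and> trans r}"

definition sym_closure :: "'a rel \<Rightarrow> 'a rel"
  where "sym_closure r = r \<union> r\<inverse>"

definition catalan_pair :: "'a set \<Rightarrow> 'a rel \<Rightarrow> 'a rel \<Rightarrow> bool"
  where "catalan_pair X S R \<longleftrightarrow>
    finite X \<and>
    S \<in> strict_orders X \<and>
    R \<in> strict_orders X \<and>
    sym_closure R \<union> sym_closure S = X \<times> X - Id_on X \<and>
    sym_closure R \<inter> sym_closure S = {} \<and>
    S O R \<subseteq> R"

definition catalan_posets :: "nat \<Rightarrow> ('a set \<times> 'a rel) set"
  where "catalan_posets n = {(X, R). card X = n \<and> (\<exists>S. catalan_pair X S R)}"

definition poset_isomorphic :: "'a set \<Rightarrow> 'a rel \<Rightarrow> 'b set \<Rightarrow> 'b rel \<Rightarrow> bool"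
  where "poset_isomorphic X R Y Q \<longleftrightarrow>
    (\<exists>f. bij_betw f X Y \<and> (\<forall>x\<in>X. \<forall>y\<in>X. (x, y) \<in> R \<longleftrightarrow> (f x, f y) \<in> Q))"


section \<open>Dyck paths and their tunnels\<close>

datatype step = U | D

definition dyck_path :: "nat \<Rightarrow> step list \<Rightarrow> bool"
  where "dyck_path n P \<longleftrightarrow>
    count_list P U = n \<and> count_list P D = n \<and>
    (\<forall>Q. prefix Q P \<longrightarrow> count_list Q D \<le> count_list Q U)"

text \<open>
  A tunnel is encoded by the pair of 0-based positions of its up step and its down step.
  An up step matches a down step to its right iff the factor strictly between them is a
  (possibly empty) Dyck path.
\<close>

definition tunnels :: "step list \<Rightarrow> (nat \<times> nat) set"
  where "tunnels P =
    {(length A, Suc (length A + length B)) | A B C.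
       P = A @ [U] @ B @ [D] @ C \<and> (\<exists>k. dyck_path k B)}"

definition tunnel_left :: "step list \<Rightarrow> (nat \<times> nat) rel"
  where "tunnel_left P = {(x, y). x \<in> tunnels P \<and> y \<in> tunnels P \<and> snd x < fst y}"

definition associated_dyck_path :: "nat \<Rightarrow> 'a set \<Rightarrow> 'a rel \<Rightarrow> step list \<Rightarrow> bool"
  where "associated_dyck_path n X R P \<longleftrightarrow>
    dyck_path n P \<and> poset_isomorphic X R (tunnels P) (tunnel_left P)"

definition starts_with_peak :: "step list \<Rightarrow> bool"
  where "starts_with_peak P \<longleftrightarrow> prefix [U, D] P"

definition ends_with_peak :: "step list \<Rightarrow> bool"
  where "ends_with_peak P \<longleftrightarrow> suffix [U, D] P"

text \<open>The library predicate \<open>sublist\<close> means a factor of consecutive letters.\<close>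

definition contains_DDUU :: "step list \<Rightarrow> bool"
  where "contains_DDUU P \<longleftrightarrow> sublist [D, D, U, U] P"


section \<open>Lattices\<close>

text \<open>
  \<open>R\<close> is a strict order, so the lattice order is its reflexive closure.  The locale
  \<open>lattice\<close> admits an empty carrier; as usual in order theory, a lattice is required here
  to be nonempty.
\<close>

definition poset_of :: "'a set \<Rightarrow> 'a rel \<Rightarrow> 'a gorder"
  where "poset_of X R = \<lparr>carrier = X, eq = (=), le = (\<lambda>x y. x = y \<or> (x, y) \<in> R)\<rparr>"

definition is_lattice :: "'a set \<Rightarrow> 'a rel \<Rightarrow> bool"
  where "is_lattice X R \<longleftrightarrow> X \<noteq> {} \<and> Lattice.lattice (poset_of X R)"

end

theory Submission
  imports Defs
begin

text \<open>
  The \<open>R\<close>-order on tunnels compares positions only: \<open>x\<close> lies below \<open>y\<close> iff the down step of \<open>x\<close>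
  precedes the up step of \<open>y\<close>.  Distinct tunnels are incomparable exactly when they are nested, so
  the common upper bounds of two nested tunnels are the tunnels that start after the outer one ends.

  A path starting with \<open>UU\<close> has two nested tunnels with no room for a tunnel to the left of the
  inner one, hence without a common lower bound; so in a lattice \<open>P\<close> starts with a peak and, dually,
  ends with one.  Around a factor \<open>DDUU\<close> there are two nested tunnels ending at the two \<open>D\<close>s
  and two nested tunnels starting at the two \<open>U\<close>s.  The latter two are upper bounds of
  the former two, and no tunnel fits in between, so the former two have no join.

  Conversely, consider two nested tunnels, the outer one ending at position \<open>m\<close>.  The letter before
  \<open>m\<close> is again a \<open>D\<close>, because otherwise the outer tunnel would be a peak with nothing inside.  The
  final peak guarantees an up step after \<open>m\<close>; the first such step is preceded by \<open>DD\<close>, so without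
  the factor \<open>DDUU\<close> it must be followed by a \<open>D\<close>.  It thus opens a peak, and a peak at the first
  possible position is to the left of all other tunnels that start after \<open>m\<close>: it is the join.  Meets
  come for free, since the initial peak is a least element and a finite poset with joins and a
  least element is a lattice.

  Positions are handled through the height of the path: a tunnel is an up step together with the
  first return to the height below it.
\<close>

section \<open>Joins and meets in finite posets\<close>

text \<open>
  Meets are joins of the converse relation, so this single notion serves for both.
\<close>

definition has_joins :: "'a set \<Rightarrow> 'a rel \<Rightarrow> bool"
  where "has_joins X R \<longleftrightarrow> (\<forall>x\<in>X. \<forall>y\<in>X. \<exists>s\<in>X. (x, s) \<in> R\<^sup>= \<and> (y, s) \<in> R\<^sup>= \<and>
    (\<forall>z\<in>X. (x, z) \<in> R\<^sup>= \<and> (y, z) \<in> R\<^sup>= \<longrightarrow> (s, z) \<in> R\<^sup>=))"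

lemma has_joinsE:
  assumes "has_joins X R" "x \<in> X" "y \<in> X"
  obtains s where "s \<in> X" "(x, s) \<in> R\<^sup>=" "(y, s) \<in> R\<^sup>="
    "\<And>z. z \<in> X \<Longrightarrow> (x, z) \<in> R\<^sup>= \<Longrightarrow> (y, z) \<in> R\<^sup>= \<Longrightarrow> (s, z) \<in> R\<^sup>="
  using that bspec[OF bspec[OF assms(1)[unfolded has_joins_def] assms(2)] assms(3)] by metis

lemma partial_order_poset_of:
  assumes "R \<in> strict_orders X"
  shows "partial_order (poset_of X R)"
proof -
  have "trans R" "irrefl R"
    using assms by (auto simp: strict_orders_def)
  then show ?thesis
    by unfold_locales (auto simp: poset_of_def irrefl_def dest: transD)
qed

lemma upper_semilattice_poset_of_iff:
  assumes "R \<in> strict_orders X"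
  shows "upper_semilattice (poset_of X R) \<longleftrightarrow> has_joins X R"
proof -
  interpret partial_order "poset_of X R"
    by (rule partial_order_poset_of[OF assms])
  have "upper_semilattice (poset_of X R) \<longleftrightarrow> (\<forall>x\<in>X. \<forall>y\<in>X. \<exists>s. least (poset_of X R) s (Upper (poset_of X R) {x, y}))"
    unfolding upper_semilattice_def upper_semilattice_axioms_def weak_upper_semilattice_def
      weak_upper_semilattice_axioms_def
    using partial_order_axioms weak_partial_order_axioms by (auto simp: poset_of_def)
  also have "\<dots> \<longleftrightarrow> has_joins X R"
  proof -
    have "least (poset_of X R) s (Upper (poset_of X R) {x, y}) \<longleftrightarrow>
        s \<in> X \<and> (x, s) \<in> R\<^sup>= \<and> (y, s) \<in> R\<^sup>= \<and>
        (\<forall>z\<in>X. (x, z) \<in> R\<^sup>= \<and> (y, z) \<in> R\<^sup>= \<longrightarrow> (s, z) \<in> R\<^sup>=)"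
      if "x \<in> X" "y \<in> X" for x y s
      using that by (auto simp: least_def Upper_def poset_of_def)
    then show ?thesis
      unfolding has_joins_def Bex_def by (intro ball_cong HOL.refl) simp
  qed
  finally show ?thesis .
qed

lemma lower_semilattice_poset_of_iff:
  assumes "R \<in> strict_orders X"
  shows "lower_semilattice (poset_of X R) \<longleftrightarrow> has_joins X (R\<inverse>)"
proof -
  interpret partial_order "poset_of X R"
    by (rule partial_order_poset_of[OF assms])
  have "lower_semilattice (poset_of X R) \<longleftrightarrow> (\<forall>x\<in>X. \<forall>y\<in>X. \<exists>s. greatest (poset_of X R) s (Lower (poset_of X R) {x, y}))"
    unfolding lower_semilattice_def lower_semilattice_axioms_def weak_lower_semilattice_def
      weak_lower_semilattice_axioms_def
    using partial_order_axioms weak_partial_order_axioms by (auto simp: poset_of_def)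
  also have "\<dots> \<longleftrightarrow> has_joins X (R\<inverse>)"
  proof -
    have "greatest (poset_of X R) s (Lower (poset_of X R) {x, y}) \<longleftrightarrow>
        s \<in> X \<and> (x, s) \<in> (R\<inverse>)\<^sup>= \<and> (y, s) \<in> (R\<inverse>)\<^sup>= \<and>
        (\<forall>z\<in>X. (x, z) \<in> (R\<inverse>)\<^sup>= \<and> (y, z) \<in> (R\<inverse>)\<^sup>= \<longrightarrow> (s, z) \<in> (R\<inverse>)\<^sup>=)"
      if "x \<in> X" "y \<in> X" for x y s
      using that by (auto simp: greatest_def Lower_def poset_of_def)
    then show ?thesis
      unfolding has_joins_def Bex_def by (intro ball_cong HOL.refl) simp
  qed
  finally show ?thesis .
qed

lemma is_lattice_iff_has_joins:
  assumes "R \<in> strict_orders X"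
  shows "is_lattice X R \<longleftrightarrow> X \<noteq> {} \<and> has_joins X R \<and> has_joins X (R\<inverse>)"
  unfolding is_lattice_def Lattice.lattice_def
  using upper_semilattice_poset_of_iff[OF assms] lower_semilattice_poset_of_iff[OF assms] by blast

text \<open>
  The meet of two elements is the join of their finitely many common lower bounds; the least
  element makes this set of bounds nonempty.
\<close>

lemma has_joins_converse_if_bottom:
  assumes fin: "finite X" and ord: "R \<in> strict_orders X"
    and bot: "b \<in> X" "\<forall>x\<in>X. (b, x) \<in> R\<^sup>=" and joins: "has_joins X R"
  shows "has_joins X (R\<inverse>)"
proof -
  let ?L = "poset_of X R"
  interpret upper_semilattice ?L
    using upper_semilattice_poset_of_iff[OF ord] joins by blast
  show ?thesis
    unfolding has_joins_def
  proof (intro ballI)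
    fix x y
    assume xy: "x \<in> X" "y \<in> X"
    let ?B = "{z \<in> X. (z, x) \<in> R\<^sup>= \<and> (z, y) \<in> R\<^sup>=}"
    have "?B \<noteq> {}"
      using bot xy by blast
    then have "least ?L (\<Squnion>\<^bsub>?L\<^esub> ?B) (Upper ?L ?B)"
      using fin by (intro finite_sup_least) (auto simp: poset_of_def)
    then obtain s where "least ?L s (Upper ?L ?B)"
      by blast
    then have s: "s \<in> X" "\<forall>z\<in>?B. (z, s) \<in> R\<^sup>="
        "\<And>u. u \<in> X \<Longrightarrow> \<forall>z\<in>?B. (z, u) \<in> R\<^sup>= \<Longrightarrow> (s, u) \<in> R\<^sup>="
      by (auto simp: least_def Upper_def poset_of_def)
    have "(s, x) \<in> R\<^sup>=" "(s, y) \<in> R\<^sup>="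
      by (intro s(3) xy ballI; blast)+
    then show "\<exists>s\<in>X. (x, s) \<in> (R\<inverse>)\<^sup>= \<and> (y, s) \<in> (R\<inverse>)\<^sup>= \<and>
        (\<forall>z\<in>X. (x, z) \<in> (R\<inverse>)\<^sup>= \<and> (y, z) \<in> (R\<inverse>)\<^sup>= \<longrightarrow> (s, z) \<in> (R\<inverse>)\<^sup>=)"
      using s(1,2) by (intro bexI[of _ s]) auto
  qed
qed

lemma poset_isomorphic_converse:
  "poset_isomorphic X R Y Q \<Longrightarrow> poset_isomorphic X (R\<inverse>) Y (Q\<inverse>)"
  unfolding poset_isomorphic_def by auto

lemma has_joins_isomorphic:
  assumes "poset_isomorphic X R Y Q"
  shows "has_joins X R \<longleftrightarrow> has_joins Y Q"
proof -
  obtain f where f: "bij_betw f X Y"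
    and R: "\<And>x y. x \<in> X \<Longrightarrow> y \<in> X \<Longrightarrow> (x, y) \<in> R \<longleftrightarrow> (f x, f y) \<in> Q"
    using assms unfolding poset_isomorphic_def by blast
  have R': "(x, y) \<in> R\<^sup>= \<longleftrightarrow> (f x, f y) \<in> Q\<^sup>=" if "x \<in> X" "y \<in> X" for x y
    using R[OF that] that f by (auto simp: bij_betw_def inj_on_def)
  have Y: "Y = f ` X"
    using f by (simp add: bij_betw_def)
  show ?thesis
    unfolding has_joins_def Y using R' by (simp del: Un_iff cong: ball_cong bex_cong conj_cong)
qed


section \<open>Heights and tunnels\<close>

definition height :: "step list \<Rightarrow> nat \<Rightarrow> int"
  where "height P k = int (count_list (take k P) U) - int (count_list (take k P) D)"

lemma height_0 [simp]: "height P 0 = 0"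
  by (simp add: height_def)

lemma height_Suc:
  "k < length P \<Longrightarrow> height P (Suc k) = height P k + (if P ! k = U then 1 else - 1)"
  by (cases "P ! k") (simp_all add: height_def take_Suc_conv_app_nth)

lemma dyck_path_height:
  "(\<exists>n. dyck_path n P) \<longleftrightarrow> height P (length P) = 0 \<and> (\<forall>k\<le>length P. 0 \<le> height P k)"
proof -
  have "(\<forall>Q. prefix Q P \<longrightarrow> count_list Q D \<le> count_list Q U) \<longleftrightarrow> (\<forall>k\<le>length P. 0 \<le> height P k)"
    unfolding height_def
    by (auto simp: take_is_prefix)
       (metis append_eq_conv_conj length_append le_add1 prefix_def)
  then show ?thesis
    by (auto simp: dyck_path_def height_def)
qed

text \<open>
  The down step of a tunnel makes the first return to the height below its up step.
\<close>

lemma tunnels_iff_height: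
  "(i, j) \<in> tunnels P \<longleftrightarrow> i < j \<and> j < length P \<and> P ! i = U \<and> P ! j = D \<and>
    height P (Suc j) = height P i \<and> (\<forall>k. i < k \<and> k \<le> j \<longrightarrow> height P i < height P k)"
  (is "_ \<longleftrightarrow> ?rhs")
proof -
  have factor: "(i, j) \<in> tunnels P \<longleftrightarrow> ?rhs"
    if P: "P = A @ [U] @ B @ [D] @ C" and i: "i = length A" and j: "j = Suc (length A + length B)"
    for A B C
  proof -
    have inner: "height P (Suc (i + m)) = height P i + 1 + height B m" if "m \<le> length B" for m
      using that unfolding P i height_def by simp
    have last: "height P (Suc j) = height P i + height B (length B)"
      unfolding P i j height_def by simp
    have pos: "P ! i = U" "P ! j = D" "i < j" "j < length P"
      unfolding P i j by (simp_all add: nth_append)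
    have "(\<forall>k. i < k \<and> k \<le> j \<longrightarrow> height P i < height P k) \<longleftrightarrow>
        (\<forall>m\<le>length B. height P i < height P (Suc (i + m)))"
      unfolding i j by (metis Suc_le_mono add_le_cancel_left less_add_Suc1 less_iff_Suc_add)
    also have "\<dots> \<longleftrightarrow> (\<forall>m\<le>length B. 0 \<le> height B m)"
      using inner by auto
    finally have rhs: "?rhs \<longleftrightarrow> (\<exists>n. dyck_path n B)"
      unfolding dyck_path_height using last pos by auto
    have "B = B'" if "P = A' @ [U] @ B' @ [D] @ C'" "i = length A'" "j = Suc (length A' + length B')"
      for A' B' C'
      using that P i j by auto
    then have "(i, j) \<in> tunnels P \<longleftrightarrow> (\<exists>n. dyck_path n B)"
      unfolding tunnels_def using P i j by blast
    then show ?thesis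
      using rhs by simp
  qed
  show ?thesis
  proof
    assume "(i, j) \<in> tunnels P"
    then show ?rhs
      using factor unfolding tunnels_def by blast
  next
    assume r: ?rhs
    let ?B = "take (j - Suc i) (drop (Suc i) P)"
    have "P = take i P @ P ! i # drop (Suc i) P"
      using r by (intro id_take_nth_drop) simp
    moreover have "drop (Suc i) P = ?B @ drop j P"
      using r by (metis Suc_leI append_take_drop_id drop_drop le_add_diff_inverse2)
    moreover have "drop j P = D # drop (Suc j) P"
      using r by (metis Cons_nth_drop_Suc)
    ultimately have "P = take i P @ [U] @ ?B @ [D] @ drop (Suc j) P"
      using r by simp
    from factor[OF this] r show "(i, j) \<in> tunnels P"
      by auto
  qed
qed

lemma tunnel_steps:
  assumes "x \<in> tunnels P"
  shows "fst x < snd x" "snd x < length P" "P ! fst x = U" "P ! snd x = D"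
  using assms tunnels_iff_height[of "fst x" "snd x" P] by simp_all

lemma peak_tunnel:
  assumes "P ! i = U" "P ! Suc i = D" "Suc i < length P"
  shows "(i, Suc i) \<in> tunnels P"
proof -
  have "height P (Suc i) = height P i + 1" "height P (Suc (Suc i)) = height P i"
    using assms by (simp_all add: height_Suc)
  moreover have "height P i < height P k" if "i < k" "k \<le> Suc i" for k
  proof -
    have "k = Suc i"
      using that by simp
    then show ?thesis
      using calculation by simp
  qed
  ultimately show ?thesis
    using assms unfolding tunnels_iff_height by auto
qed

text \<open>
  Tunnels that share a step coincide, and tunnels do not cross: otherwise one of the two would
  contain a point of the path at or below its own base before its down step.
\<close>

lemma tunnels_noncrossing:
  assumes "(i, j) \<in> tunnels P" "(i', j') \<in> tunnels P" "(i, j) \<noteq> (i', j')"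
  shows "j < i' \<or> j' < i \<or> i < i' \<and> j' < j \<or> i' < i \<and> j < j'"
proof -
  note t = assms(1,2)[unfolded tunnels_iff_height]
  have base: "height P (Suc j) = height P i" "height P (Suc j') = height P i'"
    and above: "\<And>k. i < k \<Longrightarrow> k \<le> j \<Longrightarrow> height P i < height P k"
      "\<And>k. i' < k \<Longrightarrow> k \<le> j' \<Longrightarrow> height P i' < height P k"
    and less: "i < j" "i' < j'"
    using t by auto
  have "j \<noteq> i'" "j' \<noteq> i"
    using t by auto
  moreover have "i \<noteq> i' \<or> j = j'"
    using above(1)[of "Suc j'"] above(2)[of "Suc j"] base less
    by (cases j j' rule: linorder_cases) auto
  moreover have "j \<noteq> j' \<or> i = i'"
    using above(1)[of i'] above(2)[of i] base less
    by (cases i i' rule: linorder_cases) auto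
  moreover have "\<not> (i < i' \<and> i' < j \<and> j < j')"
    using above(1)[of i'] above(2)[of "Suc j"] base by auto
  moreover have "\<not> (i' < i \<and> i < j' \<and> j' < j)"
    using above(2)[of i] above(1)[of "Suc j'"] base by auto
  ultimately show ?thesis
    using assms(3) by fastforce
qed

text \<open>
  The matching down step is found at the first return of the path to the height below the up step;
  such a return exists because the path ends at height \<open>0\<close>.
\<close>

lemma ex_tunnel_from_up_step:
  assumes "dyck_path n P" "i < length P" "P ! i = U"
  obtains j where "(i, j) \<in> tunnels P"
proof -
  have h: "height P (length P) = 0" "\<And>k. k \<le> length P \<Longrightarrow> 0 \<le> height P k"
    using assms(1) dyck_path_height by blast+
  define k where "k = (LEAST k. i < k \<and> height P k \<le> height P i)"
  have ex: "i < length P \<and> height P (length P) \<le> height P i"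
    using h assms(2) by simp
  have k: "i < k" "height P k \<le> height P i" "k \<le> length P"
    using LeastI[of "\<lambda>k. i < k \<and> height P k \<le> height P i", OF ex] Least_le[of "\<lambda>k. i < k \<and> height P k \<le> height P i", OF ex]
    unfolding k_def by auto
  have below: "height P i < height P m" if "i < m" "m < k" for m
    using not_less_Least[of m "\<lambda>k. i < k \<and> height P k \<le> height P i"] that unfolding k_def by auto
  obtain j where j: "k = Suc j"
    using k(1) by (cases k) auto
  have "i \<noteq> j"
    using k j assms(3) height_Suc[OF assms(2)] by auto
  then have "i < j"
    using k(1) j by simp
  then have "height P i < height P j"
    using below j by simp
  then have "P ! j = D" "height P (Suc j) = height P i"
    using k height_Suc[of j P] j by (cases "P ! j"; simp)+
  then have "(i, j) \<in> tunnels P"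
    unfolding tunnels_iff_height using \<open>i < j\<close> k j below assms(3) by auto
  then show thesis
    by (rule that)
qed

text \<open>
  Dually, the matching up step is at the last visit before the down step to a height not above the
  one reached after it; the start of the path, at height \<open>0\<close>, is such a visit.
\<close>

lemma ex_tunnel_to_down_step:
  assumes "dyck_path n P" "j < length P" "P ! j = D"
  obtains i where "(i, j) \<in> tunnels P"
proof -
  have h: "\<And>k. k \<le> length P \<Longrightarrow> 0 \<le> height P k"
    using assms(1) dyck_path_height by blast
  have down: "height P (Suc j) = height P j - 1"
    using height_Suc[OF assms(2)] assms(3) by simp
  let ?Q = "\<lambda>k. k \<le> j \<and> height P k \<le> height P (Suc j)"
  define i where "i = (GREATEST k. ?Q k)"
  have "?Q 0"
    using h[of "Suc j"] assms(2) by simp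
  then have i: "?Q i" and above: "\<And>k. ?Q k \<Longrightarrow> k \<le> i"
    unfolding i_def using GreatestI_nat[of ?Q 0 j] Greatest_le_nat[of ?Q _ j] by auto
  have "i < j"
    using i down by (cases "i = j") auto
  then have "height P (Suc j) < height P (Suc i)"
    using above[of "Suc i"] by fastforce
  then have "P ! i = U" "height P (Suc j) = height P i"
    using i height_Suc[of i P] \<open>i < j\<close> assms(2) by (auto split: if_splits)
  then have "(i, j) \<in> tunnels P"
    unfolding tunnels_iff_height using \<open>i < j\<close> assms(2,3) above by (auto simp: not_le[symmetric])
  then show thesis
    by (rule that)
qed

lemma dyck_path_first_step:
  assumes "dyck_path n P" "P \<noteq> []"
  shows "P ! 0 = U"
proof -
  have "0 \<le> height P (Suc 0)"
    using assms dyck_path_height[of P] by (auto simp: Suc_le_eq)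
  then show ?thesis
    using height_Suc[of 0 P] assms(2) by (auto split: if_splits)
qed

lemma dyck_path_last_step:
  assumes "dyck_path n P" "P \<noteq> []"
  shows "P ! (length P - 1) = D"
proof -
  have "height P (length P) = 0" "0 \<le> height P (length P - 1)"
    using assms dyck_path_height[of P] by auto
  then show ?thesis
    using height_Suc[of "length P - 1" P] assms(2) by (cases "P ! (length P - 1)") auto
qed

lemma dyck_path_length_ge_2:
  assumes "dyck_path n P" "P \<noteq> []"
  shows "2 \<le> length P"
proof (rule ccontr)
  assume "\<not> 2 \<le> length P"
  then have "length P - 1 = 0"
    by simp
  then show False
    using dyck_path_first_step[OF assms] dyck_path_last_step[OF assms] by simp
qed

lemma tunnels_eq_empty_iff:
  assumes "dyck_path n P"
  shows "tunnels P = {} \<longleftrightarrow> P = []"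
proof
  assume "tunnels P = {}"
  then show "P = []"
    using ex_tunnel_from_up_step[OF assms, of 0] dyck_path_first_step[OF assms] by auto
qed (auto simp: tunnels_def)

lemma tunnel_left_strict_order: "tunnel_left P \<in> strict_orders (tunnels P)"
proof -
  have "irrefl (tunnel_left P)"
    using tunnel_steps(1) by (fastforce simp: irrefl_def tunnel_left_def)
  moreover have "trans (tunnel_left P)"
  proof (rule transI)
    fix x y z
    assume "(x, y) \<in> tunnel_left P" "(y, z) \<in> tunnel_left P"
    then show "(x, z) \<in> tunnel_left P"
      using tunnel_steps(1)[of y P] by (simp add: tunnel_left_def)
  qed
  ultimately show ?thesis
    by (auto simp: strict_orders_def tunnel_left_def)
qed


section \<open>The three patterns in terms of positions\<close>

lemma starts_with_peak_iff_nth: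
  "starts_with_peak P \<longleftrightarrow> 2 \<le> length P \<and> P ! 0 = U \<and> P ! 1 = D"
proof (cases P)
  case (Cons a Q)
  then show ?thesis
    by (cases Q) (auto simp: starts_with_peak_def)
qed (simp add: starts_with_peak_def)

lemma ends_with_peak_iff_nth:
  "ends_with_peak P \<longleftrightarrow> 2 \<le> length P \<and> P ! (length P - 2) = U \<and> P ! (length P - 1) = D"
  unfolding ends_with_peak_def
proof
  assume "suffix [U, D] P"
  then show "2 \<le> length P \<and> P ! (length P - 2) = U \<and> P ! (length P - 1) = D"
    by (auto simp: suffix_def nth_append)
next
  assume e: "2 \<le> length P \<and> P ! (length P - 2) = U \<and> P ! (length P - 1) = D"
  then have "drop (length P - 2) P = P ! (length P - 2) # drop (Suc (length P - 2)) P"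
    by (intro Cons_nth_drop_Suc[symmetric]) linarith
  moreover have "Suc (length P - 2) = length P - 1"
    using e by linarith
  moreover have "drop (length P - 1) P = P ! (length P - 1) # drop (Suc (length P - 1)) P"
    using e by (intro Cons_nth_drop_Suc[symmetric]) linarith
  ultimately have "drop (length P - 2) P = [U, D]"
    using e by simp
  then show "suffix [U, D] P"
    by (metis suffix_drop)
qed

lemma contains_DDUU_iff_nth:
  "contains_DDUU P \<longleftrightarrow>
    (\<exists>i. i + 3 < length P \<and> P ! i = D \<and> P ! (i + 1) = D \<and> P ! (i + 2) = U \<and> P ! (i + 3) = U)"
  (is "_ \<longleftrightarrow> (\<exists>i. ?at i)")
proof
  assume "contains_DDUU P"
  then obtain A B where "P = A @ [D, D, U, U] @ B"
    unfolding contains_DDUU_def sublist_def by blast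
  then have "?at (length A)"
    by (simp add: nth_append)
  then show "\<exists>i. ?at i" ..
next
  assume "\<exists>i. ?at i"
  then obtain i where i: "?at i" ..
  then have "drop i P = [D, D, U, U] @ drop (i + 4) P"
    by (simp add: Cons_nth_drop_Suc[symmetric] eval_nat_numeral)
  then have "P = take i P @ [D, D, U, U] @ drop (i + 4) P"
    by (metis append_take_drop_id)
  then show "contains_DDUU P"
    unfolding contains_DDUU_def sublist_def by blast
qed


section \<open>Necessity of the conditions\<close>

lemma starts_with_peak_if_meets:
  assumes P: "dyck_path n P" "P \<noteq> []" and meets: "has_joins (tunnels P) ((tunnel_left P)\<inverse>)"
  shows "starts_with_peak P"
proof (rule ccontr)
  have len: "2 \<le> length P" and P0: "P ! 0 = U"
    using dyck_path_length_ge_2[OF P] dyck_path_first_step[OF P] by auto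
  assume "\<not> starts_with_peak P"
  then have P1: "P ! 1 = U"
    using len P0 step.exhaust[of "P ! 1"] by (auto simp: starts_with_peak_iff_nth)
  obtain j where j: "(0, j) \<in> tunnels P"
    using ex_tunnel_from_up_step[OF P(1) _ P0] P(2) by blast
  obtain k where k: "(1, k) \<in> tunnels P"
    using ex_tunnel_from_up_step[OF P(1) _ P1] len by (metis Suc_1 Suc_le_eq One_nat_def)
  obtain s where s: "s \<in> tunnels P" "((0, j), s) \<in> ((tunnel_left P)\<inverse>)\<^sup>="
      "((1, k), s) \<in> ((tunnel_left P)\<inverse>)\<^sup>="
    by (rule has_joinsE[OF meets j k]) (rule that)
  have "s = (0, j) \<or> snd s < 0" "s = (1, k) \<or> snd s < 1"
    using s(2,3) by (auto simp: tunnel_left_def)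
  moreover have "\<not> snd s < 1"
    using tunnel_steps(1)[OF s(1)] by linarith
  ultimately have "s = (0, j)" "s = (1, k)"
    by simp_all
  then show False
    by simp
qed

lemma ends_with_peak_if_joins:
  assumes P: "dyck_path n P" "P \<noteq> []" and joins: "has_joins (tunnels P) (tunnel_left P)"
  shows "ends_with_peak P"
proof (rule ccontr)
  have len: "2 \<le> length P" and last: "P ! (length P - 1) = D"
    using dyck_path_length_ge_2[OF P] dyck_path_last_step[OF P] by auto
  assume "\<not> ends_with_peak P"
  then have last2: "P ! (length P - 2) = D"
    using len last step.exhaust[of "P ! (length P - 2)"] by (auto simp: ends_with_peak_iff_nth)
  have lengths: "length P - 1 < length P" "length P - 2 < length P"
    using len by simp_all
  obtain i where i: "(i, length P - 1) \<in> tunnels P"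
    by (rule ex_tunnel_to_down_step[OF P(1) lengths(1) last])
  obtain k where k: "(k, length P - 2) \<in> tunnels P"
    by (rule ex_tunnel_to_down_step[OF P(1) lengths(2) last2])
  obtain s where s: "s \<in> tunnels P" "((i, length P - 1), s) \<in> (tunnel_left P)\<^sup>="
      "((k, length P - 2), s) \<in> (tunnel_left P)\<^sup>="
    by (rule has_joinsE[OF joins i k]) (rule that)
  show False
    using tunnel_steps(1,2)[OF s(1)] s(2,3) len by (auto simp: tunnel_left_def)
qed

lemma no_DDUU_if_joins:
  assumes P: "dyck_path n P" and joins: "has_joins (tunnels P) (tunnel_left P)"
  shows "\<not> contains_DDUU P"
proof
  assume "contains_DDUU P"
  then obtain i where i: "i + 3 < length P" "P ! i = D" "P ! (i + 1) = D" "P ! (i + 2) = U"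
      "P ! (i + 3) = U"
    unfolding contains_DDUU_iff_nth by blast
  have lengths: "i < length P" "i + 1 < length P" "i + 2 < length P"
    using i(1) by simp_all
  obtain a where a: "(a, i) \<in> tunnels P"
    by (rule ex_tunnel_to_down_step[OF P lengths(1) i(2)])
  obtain b where b: "(b, i + 1) \<in> tunnels P"
    by (rule ex_tunnel_to_down_step[OF P lengths(2) i(3)])
  obtain c where c: "(i + 2, c) \<in> tunnels P"
    by (rule ex_tunnel_from_up_step[OF P lengths(3) i(4)])
  obtain d where d: "(i + 3, d) \<in> tunnels P"
    by (rule ex_tunnel_from_up_step[OF P i(1) i(5)])
  obtain s where s: "s \<in> tunnels P" "((a, i), s) \<in> (tunnel_left P)\<^sup>="
      "((b, i + 1), s) \<in> (tunnel_left P)\<^sup>="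
      "\<And>z. z \<in> tunnels P \<Longrightarrow> ((a, i), z) \<in> (tunnel_left P)\<^sup>= \<Longrightarrow>
        ((b, i + 1), z) \<in> (tunnel_left P)\<^sup>= \<Longrightarrow> (s, z) \<in> (tunnel_left P)\<^sup>="
    by (rule has_joinsE[OF joins a b]) (rule that)
  have "(s, (i + 2, c)) \<in> (tunnel_left P)\<^sup>="
    by (rule s(4)) (use a b c in \<open>simp_all add: tunnel_left_def\<close>)
  moreover have "(s, (i + 3, d)) \<in> (tunnel_left P)\<^sup>="
    by (rule s(4)) (use a b d in \<open>simp_all add: tunnel_left_def\<close>)
  ultimately have below: "s = (i + 2, c) \<or> snd s < i + 2" "s = (i + 3, d) \<or> snd s < i + 3"
    by (auto simp: tunnel_left_def)
  have "s = (a, i) \<or> i < fst s" "s = (b, i + 1) \<or> i + 1 < fst s"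
    using s(2,3) by (auto simp: tunnel_left_def)
  then have "i + 1 < fst s"
    using tunnel_steps(1)[OF b] by auto
  then have "i + 2 < snd s"
    using tunnel_steps(1)[OF s(1)] by linarith
  then have "s = (i + 2, c)" "s = (i + 3, d)"
    using below by auto
  then show False
    by simp
qed


section \<open>Sufficiency of the conditions\<close>

text \<open>
  The outer of two nested tunnels ends with \<open>DD\<close>, so the first up step \<open>u\<close> after it is preceded by
  \<open>DD\<close> as well; avoiding \<open>DDUU\<close> then makes it open a peak.
\<close>

lemma join_of_nested_tunnels:
  assumes ends: "ends_with_peak P" and no: "\<not> contains_DDUU P"
    and x: "(i, j) \<in> tunnels P" and y: "(a, m) \<in> tunnels P" and nested: "a < i" "j < m"
  obtains u where "(u, Suc u) \<in> tunnels P" "m < u" "\<And>z. z \<in> tunnels P \<Longrightarrow> m < fst z \<Longrightarrow> u \<le> fst z"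
proof -
  have t: "i < j" "a < m" "m < length P" "P ! m = D"
    using tunnel_steps[OF x] tunnel_steps[OF y] by simp_all
  have e: "2 \<le> length P" "P ! (length P - 2) = U" "P ! (length P - 1) = D"
    using ends by (auto simp: ends_with_peak_iff_nth)
  have before: "P ! (m - 1) = D"
  proof (rule ccontr)
    assume "P ! (m - 1) \<noteq> D"
    then have "P ! (m - 1) = U"
      using step.exhaust by blast
    then have "(m - 1, m) \<in> tunnels P"
      using peak_tunnel[of P "m - 1"] t nested by simp
    moreover have "a + 2 < m"
      using t nested by linarith
    ultimately show False
      using tunnels_noncrossing[of "m - 1" m P a m] y by fastforce
  qed
  have "m \<noteq> length P - 2"
    using t e by auto
  moreover have "m \<noteq> length P - 1"
  proof
    assume "m = length P - 1"
    then have "m - 1 = length P - 2"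
      by simp
    then show False
      using before e by simp
  qed
  ultimately have ex: "m < length P - 2 \<and> P ! (length P - 2) = U"
    using t e by auto
  let ?Q = "\<lambda>u. m < u \<and> P ! u = U"
  define u where "u = (LEAST u. ?Q u)"
  have u: "m < u" "P ! u = U" "u \<le> length P - 2" and least: "\<And>k. ?Q k \<Longrightarrow> u \<le> k"
    unfolding u_def using LeastI[of ?Q, OF ex] Least_le[of ?Q, OF ex] Least_le[of ?Q] by blast+
  have down: "P ! k = D" if "m - 1 \<le> k" "k < u" for k
  proof (cases "m < k")
    case True
    then show ?thesis
      using least[of k] that step.exhaust[of "P ! k"] by auto
  next
    case False
    then have "k = m - 1 \<or> k = m"
      using that by linarith
    then show ?thesis
      using before t by auto
  qed
  \<comment> \<open>The letters at \<open>u - 2\<close> and \<open>u - 1\<close> are both \<open>D\<close>, so a \<open>U\<close> after \<open>u\<close> would complete \<open>DDUU\<close>.\<close>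
  have "P ! Suc u = D"
  proof (rule ccontr)
    assume "P ! Suc u \<noteq> D"
    then have up: "P ! Suc u = U"
      using step.exhaust by blast
    then have "Suc u \<noteq> length P - 1"
      using e by auto
    then have "Suc u < length P"
      using u e by linarith
    define v where "v = u - 2"
    have v: "u = v + 2" "m - 1 \<le> v"
      using u t nested unfolding v_def by auto
    have "contains_DDUU P"
      unfolding contains_DDUU_iff_nth
      using down[of v] down[of "v + 1"] v up u \<open>Suc u < length P\<close>
      by (intro exI[of _ v]) (auto simp: eval_nat_numeral)
    then show False
      using no by simp
  qed
  moreover have "Suc u < length P"
    using u e by linarith
  ultimately have "(u, Suc u) \<in> tunnels P"
    using u by (intro peak_tunnel)
  moreover have "u \<le> fst z" if "z \<in> tunnels P" "m < fst z" for z
    using that least tunnel_steps(3) by blast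
  ultimately show thesis
    using that u by blast
qed

lemma has_joins_if_no_DDUU:
  assumes "ends_with_peak P" "\<not> contains_DDUU P"
  shows "has_joins (tunnels P) (tunnel_left P)"
proof -
  let ?T = "tunnels P" and ?le = "(tunnel_left P)\<^sup>="
  let ?join = "\<lambda>x y s. s \<in> ?T \<and> (x, s) \<in> ?le \<and> (y, s) \<in> ?le \<and>
    (\<forall>z\<in>?T. (x, z) \<in> ?le \<and> (y, z) \<in> ?le \<longrightarrow> (s, z) \<in> ?le)"
  have nested: "\<exists>s. ?join x y s"
    if xy: "x \<in> ?T" "y \<in> ?T" and n: "fst y < fst x" "snd x < snd y" for x y
  proof -
    obtain u where u: "(u, Suc u) \<in> ?T" "snd y < u"
      and least: "\<And>z. z \<in> ?T \<Longrightarrow> snd y < fst z \<Longrightarrow> u \<le> fst z"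
      using join_of_nested_tunnels[OF assms, of "fst x" "snd x" "fst y" "snd y"] xy n by auto
    have "((u, Suc u), z) \<in> ?le" if z: "z \<in> ?T" "(x, z) \<in> ?le" "(y, z) \<in> ?le" for z
    proof -
      have "fst x < snd x"
        using xy(1) by (rule tunnel_steps)
      then have "snd y < fst z"
        using z n by (auto simp: tunnel_left_def)
      then have "u \<le> fst z"
        using least z by blast
      then show ?thesis
        using tunnels_noncrossing[OF u(1), of "fst z" "snd z"] z u(1)
          tunnel_steps[OF z(1)]
        by (cases "(u, Suc u) = z") (auto simp: tunnel_left_def)
    qed
    then have "?join x y (u, Suc u)"
      using u xy n by (auto simp: tunnel_left_def)
    then show ?thesis ..
  qed
  have "\<exists>s. ?join x y s" if xy: "x \<in> ?T" "y \<in> ?T" for x y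
  proof -
    consider "(x, y) \<in> ?le" | "(y, x) \<in> ?le" | "fst y < fst x \<and> snd x < snd y"
      | "fst x < fst y \<and> snd y < snd x"
      using tunnels_noncrossing[of "fst x" "snd x" P "fst y" "snd y"] xy
      by (auto simp: tunnel_left_def)
    then show ?thesis
    proof cases
      case 1
      then have "?join x y y"
        using xy by blast
      then show ?thesis ..
    next
      case 2
      then have "?join x y x"
        using xy by blast
      then show ?thesis ..
    next
      case 3
      then show ?thesis
        using nested[OF xy] by blast
    next
      case 4
      then obtain s where "?join y x s"
        using nested[OF xy(2,1)] by blast
      then have "?join x y s"
        by blast
      then show ?thesis ..
    qed
  qed
  then show ?thesis
    unfolding has_joins_def by blast
qed

lemma initial_peak_least:
  assumes "starts_with_peak P"
  shows "(0, 1) \<in> tunnels P" "\<forall>x\<in>tunnels P. ((0, 1), x) \<in> (tunnel_left P)\<^sup>="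
proof -
  show t: "(0, 1) \<in> tunnels P"
    using peak_tunnel[of P 0] assms by (auto simp: starts_with_peak_iff_nth)
  show "\<forall>x\<in>tunnels P. ((0, 1), x) \<in> (tunnel_left P)\<^sup>="
  proof
    fix x
    assume x: "x \<in> tunnels P"
    show "((0, 1), x) \<in> (tunnel_left P)\<^sup>="
      using tunnels_noncrossing[OF t, of "fst x" "snd x"] x t tunnel_steps[OF x]
      by (cases "(0, 1) = x") (auto simp: tunnel_left_def)
  qed
qed

lemma finite_tunnels: "finite (tunnels P)"
proof (rule finite_subset)
  show "tunnels P \<subseteq> {..<length P} \<times> {..<length P}"
  proof
    fix x
    assume "x \<in> tunnels P"
    from tunnel_steps(1,2)[OF this] show "x \<in> {..<length P} \<times> {..<length P}"
      by (cases x) simp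
  qed
qed simp


section \<open>The characterization\<close>

theorem proposition4p4:
  fixes X :: "'a set" and R :: "'a rel" and n :: nat and P :: "step list"
  assumes "(X, R) \<in> catalan_posets n"
    and "associated_dyck_path n X R P"
  shows "is_lattice X R \<longleftrightarrow>
    starts_with_peak P \<and> ends_with_peak P \<and> \<not> contains_DDUU P"
proof -
  let ?T = "tunnels P" and ?L = "tunnel_left P"
  have P: "dyck_path n P" and iso: "poset_isomorphic X R ?T ?L"
    using assms(2) by (auto simp: associated_dyck_path_def)
  have "R \<in> strict_orders X"
    using assms(1) by (auto simp: catalan_posets_def catalan_pair_def)
  moreover have "X = {} \<longleftrightarrow> ?T = {}"
    using iso unfolding poset_isomorphic_def bij_betw_def by auto
  ultimately have lattice: "is_lattice X R \<longleftrightarrow>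
      P \<noteq> [] \<and> has_joins ?T ?L \<and> has_joins ?T (?L\<inverse>)"
    using is_lattice_iff_has_joins has_joins_isomorphic[OF iso]
      has_joins_isomorphic[OF poset_isomorphic_converse[OF iso]] tunnels_eq_empty_iff[OF P]
    by blast
  show ?thesis
  proof
    assume "is_lattice X R"
    then show "starts_with_peak P \<and> ends_with_peak P \<and> \<not> contains_DDUU P"
      using lattice starts_with_peak_if_meets[OF P] ends_with_peak_if_joins[OF P]
        no_DDUU_if_joins[OF P] by blast
  next
    assume r: "starts_with_peak P \<and> ends_with_peak P \<and> \<not> contains_DDUU P"
    then have joins: "has_joins ?T ?L"
      using has_joins_if_no_DDUU by blast
    moreover have "has_joins ?T (?L\<inverse>)"
      using has_joins_converse_if_bottom[OF finite_tunnels tunnel_left_strict_order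
          initial_peak_least joins] r by blast
    moreover have "P \<noteq> []"
      using r by (auto simp: starts_with_peak_iff_nth)
    ultimately show "is_lattice X R"
      using lattice by blast
  qed
qed

end
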